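(* Let $\mathcal{S}\in\mathbb{C}^{p\times q\times n}$, $\mathcal{T}\in\mathbb{C}^{q\times p\times n}$, $\mathrm{rank}_t(\mathcal{T})=sn$ and $\mathrm{rank}_t(\mathcal{S})=rn$ with $sn\le rn$. Suppose that $$\mathcal{T}*\mathcal{P}=\mathcal{Q}*\mathcal{R},$$ where $\mathcal{P}\in\mathbb{C}^{p\times p\times n}$ is a permutation tensor, $\mathcal{Q}\in\mathbb{C}^{q\times q\times n}$ satisfies $\mathcal{Q}^**\mathcal{Q}=\mathcal{I}_{qqn}$, and $\mathcal{R}\in\mathbb{C}^{q\times p\times n}$ has $\mathrm{rank}_t(\mathcal{R})=sn$, and that $\mathcal{P}$ is chosen so that $\mathcal{Q}$ and $\mathcal{R}$ are partitioned as $$\mathcal{Q}=\begin{bmatrix}\tilde{\mathcal{Q}} & \mathcal{Q}_2\end{bmatrix},\qquad \mathcal{R}=\begin{bmatrix}\mathcal{R}_{11} & \mathcal{R}_{22}\\ \mathcal{O} & \mathcal{O}\end{bmatrix}=\begin{bmatrix}\tilde{\mathcal{R}}\\ \mathcal{O}\end{bmatrix},$$ where $\tilde{\mathcal{Q}}\in\mathbb{C}^{q\times s\times n}$, $\mathcal{R}_{11}\in\mathbb{C}^{s\times s\times n}$ is nonsingular (invertible) and $\tilde{\mathcal{R}}\in\mathbb{C}^{s\times p\times n}$. If $\mathcal{S}^{(2)}_{\mathscr{R}(\mathcal{T}),\mathscr{N}(\mathcal{T})}$ exists, then: (i) $\tilde{\mathcal{R}}*\mathcal{P}^**\mathcal{S}*\tilde{\mathcal{Q}}$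 is invertible. (ii) $\mathcal{S}^{(2)}_{\mathscr{R}(\mathcal{T}),\mathscr{N}(\mathcal{T})}=\tilde{\mathcal{Q}}*(\tilde{\mathcal{R}}*\mathcal{P}^**\mathcal{S}*\tilde{\mathcal{Q}})^{-1}*\tilde{\mathcal{R}}*\mathcal{P}^*$. (iii) $\mathcal{S}^{(2)}_{\mathscr{R}(\mathcal{T}),\mathscr{N}(\mathcal{T})}=\mathcal{S}^{(2)}_{\mathscr{R}(\tilde{\mathcal{Q}}),\mathscr{N}(\tilde{\mathcal{R}}*\mathcal{P}^* )}$. (iv) $\mathcal{S}^{(2)}_{\mathscr{R}(\mathcal{T}),\mathscr{N}(\mathcal{T})}=\tilde{\mathcal{Q}}*(\tilde{\mathcal{Q}}^**\mathcal{T}*\mathcal{S}*\tilde{\mathcal{Q}})^{-1}*\tilde{\mathcal{Q}}^**\mathcal{T}$.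
   Context: A third-order tensor $\mathcal{A}\in\mathbb{C}^{a\times b\times n}$ has frontal slices $A_1,\dots,A_n\in\mathbb{C}^{a\times b}$, $A_k=\mathcal{A}(:,:,k)$. $\mathrm{bcirc}(\mathcal{A})\in\mathbb{C}^{an\times bn}$ is the block circulant matrix whose $(i,j)$ block ($1\le i,j\le n$) is $A_{((i-j)\bmod n)+1}$. For $\mathcal{A}\in\mathbb{C}^{a\times b\times n}$ and $\mathcal{B}\in\mathbb{C}^{b\times c\times n}$, the $t$-product $\mathcal{A}*\mathcal{B}\in\mathbb{C}^{a\times c\times n}$ is the unique tensor with $\mathrm{bcirc}(\mathcal{A}*\mathcal{B})=\mathrm{bcirc}(\mathcal{A})\,\mathrm{bcirc}(\mathcal{B})$. $\mathcal{I}_{qqn}\in\mathbb{C}^{q\times q\times n}$ is the identity tensor ($\mathrm{bcirc}(\mathcal{I}_{qqn})$ is the identity matrix); a tensor in $\mathbb{C}^{m\times m\times n}$ is invertible (nonsingular) if it has a two-sided inverse for $*$ with respect to $\mathcal{I}_{mmn}$. $\mathcal{A}^*$ (superscript) is the conjugate transpose, i.e. the tensor with $\mathrm{bcirc}(\mathcal{A}^* )=\mathrm{bcirc}(\mathcal{A})^*$. $\mathcal{O}$ denotes zero tensors; block partitions of tensors mean that each frontal slice is partitioned accordingly. A permutation tensor $\mathcal{P}\in\mathbb{C}^{p\times p\times n}$ is a tensor all of whose slices after the discrete Fourier transform along the third mode, $\hat P_j=\sum_{k=1}^n \omega^{(j-1)(k-1)}P_k$ with $\omega=e^{-2\pi i/n}$,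 $j=1,\dots,n$, are permutation matrices. The $t$-range space $\mathscr{R}(\mathcal{A})$ is the range (column space) of $\mathrm{bcirc}(\mathcal{A})$, the $t$-null space $\mathscr{N}(\mathcal{A})$ is the null space of $\mathrm{bcirc}(\mathcal{A})$, and $\mathrm{rank}_t(\mathcal{A})=\mathrm{rank}(\mathrm{bcirc}(\mathcal{A}))$. For $\mathcal{S}\in\mathbb{C}^{p\times q\times n}$, $\mathcal{S}^{(2)}_{\mathscr{R}(\mathcal{B}),\mathscr{N}(\mathcal{C})}$ denotes the tensor $\mathcal{X}\in\mathbb{C}^{q\times p\times n}$ (unique if it exists) with $\mathcal{X}*\mathcal{S}*\mathcal{X}=\mathcal{X}$, $\mathscr{R}(\mathcal{X})=\mathscr{R}(\mathcal{B})$, $\mathscr{N}(\mathcal{X})=\mathscr{N}(\mathcal{C})$. *)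

theory Defs
  imports
    "HOL-Combinatorics.Permutations"
    "Jordan_Normal_Form.DL_Rank"
    "Jordan_Normal_Form.Matrix_Kernel"
    "Jordan_Normal_Form.Schur_Decomposition"
begin

section \<open>Third-order tensors and the t-product\<close>

text \<open>
  A tensor is the list of its frontal slices; slices are numbered from 0, so that
  \<open>A ! k\<close> is the slice usually written with index \<open>k + 1\<close>.
\<close>

type_synonym tensor = "complex mat list"

definition tensors :: "nat \<Rightarrow> nat \<Rightarrow> nat \<Rightarrow> tensor set" where
  "tensors a b n = {A. length A = n \<and> set A \<subseteq> carrier_mat a b}"

definition trows :: "tensor \<Rightarrow> nat" where
  "trows A = dim_row (hd A)"

definition tcols :: "tensor \<Rightarrow> nat" where
  "tcols A = dim_col (hd A)"

text \<open>
  Row \<open>x\<close> lies in block row \<open>x div a\<close> and is row \<open>x mod a\<close> of that block; likewise for columns.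
\<close>

definition bcirc :: "tensor \<Rightarrow> complex mat" where
  "bcirc A = (let a = trows A; b = tcols A; n = length A in
     mat (a * n) (b * n) (\<lambda>(x, y).
       (A ! nat ((int (x div a) - int (y div b)) mod int n)) $$ (x mod a, y mod b)))"

definition of_bcirc :: "nat \<Rightarrow> nat \<Rightarrow> nat \<Rightarrow> complex mat \<Rightarrow> tensor" where
  "of_bcirc a b n M = (THE C. C \<in> tensors a b n \<and> bcirc C = M)"

definition tprod :: "tensor \<Rightarrow> tensor \<Rightarrow> tensor" (infixl \<open>*\<^sub>t\<close> 70) where
  "A *\<^sub>t B = of_bcirc (trows A) (tcols B) (length A) (bcirc A * bcirc B)"

definition tid :: "nat \<Rightarrow> nat \<Rightarrow> tensor" where
  "tid q n = of_bcirc q q n (1\<^sub>m (q * n))"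

definition tadjoint :: "tensor \<Rightarrow> tensor" where
  "tadjoint A = of_bcirc (tcols A) (trows A) (length A) (mat_adjoint (bcirc A))"

definition tzero :: "nat \<Rightarrow> nat \<Rightarrow> nat \<Rightarrow> tensor" where
  "tzero a b n = replicate n (0\<^sub>m a b)"

definition is_tinverse :: "tensor \<Rightarrow> tensor \<Rightarrow> bool" where
  "is_tinverse A B \<longleftrightarrow> (let m = trows A; n = length A in
     A \<in> tensors m m n \<and> B \<in> tensors m m n \<and> A *\<^sub>t B = tid m n \<and> B *\<^sub>t A = tid m n)"

definition tinvertible :: "tensor \<Rightarrow> bool" where
  "tinvertible A \<longleftrightarrow> (\<exists>B. is_tinverse A B)"

definition tinverse :: "tensor \<Rightarrow> tensor" where
  "tinverse A = (THE B. is_tinverse A B)"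


section \<open>Block partitions, slice by slice\<close>

definition tappend_cols :: "tensor \<Rightarrow> tensor \<Rightarrow> tensor" where
  "tappend_cols A B =
     map2 (\<lambda>X Y. four_block_mat X Y (0\<^sub>m 0 (dim_col X)) (0\<^sub>m 0 (dim_col Y))) A B"

definition tappend_rows :: "tensor \<Rightarrow> tensor \<Rightarrow> tensor" where
  "tappend_rows A B = map2 (\<lambda>X Y. X @\<^sub>r Y) A B"

definition tfour_block :: "tensor \<Rightarrow> tensor \<Rightarrow> tensor \<Rightarrow> tensor \<Rightarrow> tensor" where
  "tfour_block A B C D =
     map (\<lambda>k. four_block_mat (A ! k) (B ! k) (C ! k) (D ! k)) [0..<length A]"


section \<open>Permutation tensors\<close>

definition permutation_matrix :: "nat \<Rightarrow> complex mat \<Rightarrow> bool" where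
  "permutation_matrix p M \<longleftrightarrow>
     (\<exists>\<pi>. \<pi> permutes {..<p} \<and> M = mat p p (\<lambda>(i, j). if i = \<pi> j then 1 else 0))"

definition dft_slice :: "tensor \<Rightarrow> nat \<Rightarrow> complex mat" where
  "dft_slice A j = (let \<omega> = exp (- 2 * of_real pi * \<i> / of_nat (length A)) in
     mat (trows A) (tcols A) (\<lambda>(x, y). \<Sum>k<length A. \<omega> ^ (j * k) * (A ! k) $$ (x, y)))"

definition permutation_tensor :: "nat \<Rightarrow> nat \<Rightarrow> tensor \<Rightarrow> bool" where
  "permutation_tensor p n P \<longleftrightarrow>
     P \<in> tensors p p n \<and> (\<forall>j<n. permutation_matrix p (dft_slice P j))"


section \<open>Range, null space, rank, and outer inverses with prescribed range and null space\<close>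

definition trange :: "tensor \<Rightarrow> complex vec set" where
  "trange A = vec_space.col_space (dim_row (bcirc A)) (bcirc A)"

definition tnull :: "tensor \<Rightarrow> complex vec set" where
  "tnull A = mat_kernel (bcirc A)"

definition trank :: "tensor \<Rightarrow> nat" where
  "trank A = vec_space.rank (dim_row (bcirc A)) (bcirc A)"

definition is_outer_inverse :: "tensor \<Rightarrow> tensor \<Rightarrow> tensor \<Rightarrow> tensor \<Rightarrow> bool" where
  "is_outer_inverse S B C X \<longleftrightarrow>
     X \<in> tensors (tcols S) (trows S) (length S) \<and>
     X *\<^sub>t S *\<^sub>t X = X \<and> trange X = trange B \<and> tnull X = tnull C"

definition outer_inverse :: "tensor \<Rightarrow> tensor \<Rightarrow> tensor \<Rightarrow> tensor" where
  "outer_inverse S B C = (THE X. is_outer_inverse S B C X)"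


section \<open>The operations defined through \<open>bcirc\<close> are well defined\<close>

lemma tensors_dims:
  assumes "A \<in> tensors a b n" "0 < n"
  shows "length A = n" "trows A = a" "tcols A = b"
    "\<And>k. k < n \<Longrightarrow> A ! k \<in> carrier_mat a b"
proof -
  show l: "length A = n" using assms by (simp add: tensors_def)
  have "hd A \<in> set A" using l assms by (cases A) auto
  then show "trows A = a" "tcols A = b"
    using assms unfolding tensors_def trows_def tcols_def by auto
  show "\<And>k. k < n \<Longrightarrow> A ! k \<in> carrier_mat a b"
    using assms l by (auto simp: tensors_def)
qed

lemma bcirc_carrier:
  assumes "A \<in> tensors a b n" "0 < n"
  shows "bcirc A \<in> carrier_mat (a * n) (b * n)"
  using tensors_dims[OF assms] by (simp add: bcirc_def Let_def)

lemma bcirc_index: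
  assumes "A \<in> tensors a b n" "0 < n" "x < a * n" "y < b * n"
  shows "bcirc A $$ (x, y) =
    (A ! nat ((int (x div a) - int (y div b)) mod int n)) $$ (x mod a, y mod b)"
  using tensors_dims[OF assms(1,2)] assms by (simp add: bcirc_def Let_def)

lemma block_index_less:
  fixes a k i n :: nat
  assumes "k < n" "i < a"
  shows "k * a + i < a * n"
proof -
  have "k * a + i < Suc k * a" using assms by simp
  also have "\<dots> \<le> n * a" using assms by (intro mult_right_mono) auto
  finally show ?thesis by (simp add: mult.commute)
qed

lemma ex1_of_bcirc:
  assumes n: "0 < n" and M: "M \<in> carrier_mat (a * n) (b * n)"
    and circ: "\<And>x y. x < a * n \<Longrightarrow> y < b * n \<Longrightarrow>
      M $$ (x, y) = M $$ (nat ((int (x div a) - int (y div b)) mod int n) * a + x mod a, y mod b)"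
  shows "\<exists>!C. C \<in> tensors a b n \<and> bcirc C = M"
proof (rule ex_ex1I)
  define C where "C = map (\<lambda>k. mat a b (\<lambda>(i, j). M $$ (k * a + i, j))) [0..<n]"
  have C: "C \<in> tensors a b n" by (auto simp: C_def tensors_def)
  have "bcirc C = M"
  proof (rule eq_matI)
    fix x y assume "x < dim_row M" "y < dim_col M"
    then have xy: "x < a * n" "y < b * n" using M by auto
    then have ab: "x mod a < a" "y mod b < b"
      by (metis mod_less_divisor mult_eq_0_iff not_gr_zero not_less0)+
    let ?k = "nat ((int (x div a) - int (y div b)) mod int n)"
    have "?k < n" using n by (simp add: nat_less_iff)
    then show "bcirc C $$ (x, y) = M $$ (x, y)"
      using circ[OF xy] ab by (simp add: bcirc_index[OF C n xy]) (simp add: C_def)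
  qed (use bcirc_carrier[OF C n] M in auto)
  with C show "\<exists>C. C \<in> tensors a b n \<and> bcirc C = M" by blast
next
  fix C D
  assume C: "C \<in> tensors a b n \<and> bcirc C = M" and D: "D \<in> tensors a b n \<and> bcirc D = M"
  note tC = tensors_dims[OF conjunct1[OF C] n] and tD = tensors_dims[OF conjunct1[OF D] n]
  have "C ! k = D ! k" if k: "k < n" for k
  proof (rule eq_matI)
    fix i j assume "i < dim_row (D ! k)" "j < dim_col (D ! k)"
    then have ij: "i < a" "j < b" using tD(4)[OF k] by auto
    have xy: "k * a + i < a * n" "j < b * n"
      using block_index_less[OF k ij(1)] block_index_less[OF n ij(2)] by auto
    have "(E ! k) $$ (i, j) = bcirc E $$ (k * a + i, j)" if "E \<in> tensors a b n" for E
      using bcirc_index[OF that n xy] ij k by (simp add: zmod_int[symmetric])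
    then show "(C ! k) $$ (i, j) = (D ! k) $$ (i, j)" using C D by metis
  qed (use tC(4)[OF k] tD(4)[OF k] in auto)
  then show "C = D" using tC(1) tD(1) by (intro nth_equalityI) auto
qed

lemma of_bcirc:
  assumes "\<exists>!C. C \<in> tensors a b n \<and> bcirc C = M"
  shows "of_bcirc a b n M \<in> tensors a b n" "bcirc (of_bcirc a b n M) = M"
  using theI'[OF assms] by (auto simp: of_bcirc_def)

lemma sum_blocks:
  fixes f :: "nat \<Rightarrow> complex"
  shows "(\<Sum>z<b * n. f z) = (\<Sum>l<n. \<Sum>i<b. f (l * b + i))"
proof -
  have "(\<Sum>i<b. f (l * b + i)) = sum f {l * b..<l * b + b}" for l
    using sum.shift_bounds_nat_ivl[of f 0 "l * b" b]
    by (simp add: lessThan_atLeast0 add.commute)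
  then show ?thesis by (simp add: sum.nat_group mult.commute)
qed

lemma mod_diff_inner:
  fixes X l Y n :: int
  shows "(X - (l + Y) mod n) mod n = (X - Y - l) mod n"
  by (simp add: mod_diff_right_eq algebra_simps)

lemma sum_shift_mod:
  fixes f :: "nat \<Rightarrow> complex"
  assumes "0 < n"
  shows "(\<Sum>l<n. f l) = (\<Sum>l<n. f (nat ((int l + Y) mod int n)))"
proof (rule sum.reindex_bij_witness[where i = "\<lambda>l. nat ((int l + Y) mod int n)"
      and j = "\<lambda>l. nat ((int l - Y) mod int n)"])
qed (use assms in \<open>auto simp: nat_less_iff mod_add_left_eq mod_diff_left_eq\<close>)

lemma tprod_ex1:
  assumes A: "A \<in> tensors a b n" and B: "B \<in> tensors b c n" and n: "0 < n"
  shows "\<exists>!C. C \<in> tensors a c n \<and> bcirc C = bcirc A * bcirc B"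
proof (rule ex1_of_bcirc[OF n])
  note cA = bcirc_carrier[OF A n] and cB = bcirc_carrier[OF B n]
  show "bcirc A * bcirc B \<in> carrier_mat (a * n) (c * n)" using cA cB by auto
  have conv: "(bcirc A * bcirc B) $$ (x, y) = (\<Sum>l<n. \<Sum>i<b.
      (A ! nat ((int (x div a) - int (y div c) - int l) mod int n)) $$ (x mod a, i)
      * (B ! l) $$ (i, y mod c))" if xy: "x < a * n" "y < c * n" for x y
  proof -
    let ?X = "int (x div a)" and ?Y = "int (y div c)"
    let ?g = "\<lambda>l. \<Sum>i<b. (A ! nat ((?X - int l) mod int n)) $$ (x mod a, i)
        * (B ! nat ((int l - ?Y) mod int n)) $$ (i, y mod c)"
    have "(bcirc A * bcirc B) $$ (x, y) = (\<Sum>z<b * n. bcirc A $$ (x, z) * bcirc B $$ (z, y))"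
      using cA cB xy by (auto simp: scalar_prod_def lessThan_atLeast0 intro!: sum.cong)
    also have "\<dots> = (\<Sum>l<n. \<Sum>i<b. bcirc A $$ (x, l * b + i) * bcirc B $$ (l * b + i, y))"
      by (rule sum_blocks)
    also have "\<dots> = (\<Sum>l<n. ?g l)"
      by (intro sum.cong refl)
        (use xy in \<open>auto simp: bcirc_index[OF A n] bcirc_index[OF B n] block_index_less\<close>)
    also have "\<dots> = (\<Sum>l<n. ?g (nat ((int l + ?Y) mod int n)))"
      by (rule sum_shift_mod[OF n])
    also have "\<dots> = (\<Sum>l<n. \<Sum>i<b. (A ! nat ((?X - ?Y - int l) mod int n)) $$ (x mod a, i)
      * (B ! l) $$ (i, y mod c))"
      by (intro sum.cong refl) (use n in \<open>simp add: mod_diff_inner mod_diff_left_eq\<close>)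
    finally show ?thesis .
  qed
  fix x y assume xy: "x < a * n" "y < c * n"
  then have ac: "x mod a < a" "y mod c < c"
    by (metis mod_less_divisor mult_eq_0_iff not_gr_zero not_less0)+
  define k where "k = nat ((int (x div a) - int (y div c)) mod int n)"
  have k: "k < n" using n by (simp add: k_def nat_less_iff)
  have ik: "int k = (int (x div a) - int (y div c)) mod int n" using n by (simp add: k_def)
  have xy': "k * a + x mod a < a * n" "y mod c < c * n"
    using block_index_less[OF k ac(1)] block_index_less[OF n ac(2)] by auto
  show "(bcirc A * bcirc B) $$ (x, y) =
      (bcirc A * bcirc B) $$ (nat ((int (x div a) - int (y div c)) mod int n) * a + x mod a, y mod c)"
    unfolding k_def[symmetric] conv[OF xy] conv[OF xy'] using ac
    by (simp add: ik mod_diff_left_eq)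
qed

lemma tprod:
  assumes "A \<in> tensors a b n" "B \<in> tensors b c n" "0 < n"
  shows "A *\<^sub>t B \<in> tensors a c n" "bcirc (A *\<^sub>t B) = bcirc A * bcirc B"
  using of_bcirc[OF tprod_ex1[OF assms]] tensors_dims[OF assms(1,3)] tensors_dims[OF assms(2,3)]
  by (simp_all add: tprod_def)

lemma tid_ex1:
  assumes n: "0 < n"
  shows "\<exists>!C. C \<in> tensors q q n \<and> bcirc C = 1\<^sub>m (q * n)"
proof (rule ex1_of_bcirc[OF n])
  fix x y assume xy: "x < q * n" "y < q * n"
  then have q: "0 < q" by (cases q) auto
  define k where "k = nat ((int (x div q) - int (y div q)) mod int n)"
  have k: "k < n" using n by (simp add: k_def nat_less_iff)
  have le: "x div q < n" "y div q < n"
    using xy by (simp_all add: less_mult_imp_div_less mult.commute)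
  have "k = 0 \<longleftrightarrow> (int (x div q) - int (y div q)) mod int n = 0"
    unfolding k_def using n by (simp add: order_antisym_conv)
  also have "\<dots> \<longleftrightarrow> int (x div q) mod int n = int (y div q) mod int n"
    by (metis mod_eq_dvd_iff mod_0_imp_dvd dvd_imp_mod_0)
  also have "\<dots> \<longleftrightarrow> x div q = y div q" using le by simp
  finally have k0: "k = 0 \<longleftrightarrow> x div q = y div q" .
  have "x = y \<longleftrightarrow> x div q = y div q \<and> x mod q = y mod q"
    by (metis div_mult_mod_eq)
  also have "\<dots> \<longleftrightarrow> k * q + x mod q = y mod q"
  proof (cases "k = 0")
    case False
    then have "q \<le> k * q" by simp
    moreover have "y mod q < q" using q by simp
    ultimately have "k * q + x mod q \<noteq> y mod q" by linarith
    with False k0 show ?thesis by simp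
  qed (use k0 in simp)
  finally have "x = y \<longleftrightarrow> k * q + x mod q = y mod q" .
  moreover have "k * q + x mod q < q * n" "y mod q < q * n"
    using block_index_less[OF k, of "x mod q" q] block_index_less[OF n, of "y mod q" q] q by auto
  ultimately show "1\<^sub>m (q * n) $$ (x, y) =
      1\<^sub>m (q * n) $$ (nat ((int (x div q) - int (y div q)) mod int n) * q + x mod q, y mod q)"
    unfolding k_def[symmetric] using xy by simp
qed auto

lemma tid:
  assumes "0 < n"
  shows "tid q n \<in> tensors q q n" "bcirc (tid q n) = 1\<^sub>m (q * n)"
  using of_bcirc[OF tid_ex1[OF assms]] by (simp_all add: tid_def)

lemma mat_adjoint_index:
  assumes "M \<in> carrier_mat r c" "i < c" "j < r"
  shows "mat_adjoint M $$ (i, j) = cnj (M $$ (j, i))"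
  using assms by (simp add: mat_adjoint_def mat_of_rows_index conjugate_vec_def conjugate_complex_def)

lemma tadjoint_ex1:
  assumes A: "A \<in> tensors a b n" and n: "0 < n"
  shows "\<exists>!C. C \<in> tensors b a n \<and> bcirc C = mat_adjoint (bcirc A)"
proof (rule ex1_of_bcirc[OF n])
  note cA = bcirc_carrier[OF A n]
  show "mat_adjoint (bcirc A) \<in> carrier_mat (b * n) (a * n)"
    using cA unfolding carrier_mat_def by (simp add: mat_adjoint_def)
  fix x y assume xy: "x < b * n" "y < a * n"
  then have ba: "x mod b < b" "y mod a < a"
    by (metis mod_less_divisor mult_eq_0_iff not_gr_zero not_less0)+
  define k where "k = nat ((int (x div b) - int (y div a)) mod int n)"
  have k: "k < n" using n by (simp add: k_def nat_less_iff)
  have ik: "int k = (int (x div b) - int (y div a)) mod int n" using n by (simp add: k_def)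
  have xy': "k * b + x mod b < b * n" "y mod a < a * n"
    using block_index_less[OF k ba(1)] block_index_less[OF n ba(2)] by auto
  have "(- int k) mod int n = (int (y div a) - int (x div b)) mod int n"
    unfolding ik by (simp add: mod_minus_eq)
  then show "mat_adjoint (bcirc A) $$ (x, y) = mat_adjoint (bcirc A) $$
      (nat ((int (x div b) - int (y div a)) mod int n) * b + x mod b, y mod a)"
    unfolding k_def[symmetric] mat_adjoint_index[OF cA xy] mat_adjoint_index[OF cA xy']
      bcirc_index[OF A n xy(2,1)] bcirc_index[OF A n xy'(2,1)]
    using ba by simp
qed

lemma tadjoint:
  assumes "A \<in> tensors a b n" "0 < n"
  shows "tadjoint A \<in> tensors b a n" "bcirc (tadjoint A) = mat_adjoint (bcirc A)"
  using of_bcirc[OF tadjoint_ex1[OF assms]] tensors_dims[OF assms]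
  by (simp_all add: tadjoint_def)

end

theory Submission
  imports Defs
begin

text \<open>
  Everything follows from a full rank factorization of \<open>T\<close>. Put \<open>F = Qt\<close> and
  \<open>G = Rt * P\<^sup>*\<close>. The zero block of \<open>R\<close> annihilates \<open>Q2\<close>, so \<open>Q * R = Qt * Rt\<close>; and \<open>P\<close> is
  unitary, because its Fourier slices are. Hence \<open>T = F * G\<close>. The factor \<open>F\<close> has the left
  inverse \<open>Qt\<^sup>*\<close>, since a block of columns of the unitary tensor \<open>Q\<close> is orthonormal, and \<open>G\<close>
  has a right inverse \<open>Y\<close>, obtained by padding \<open>R11\<^sup>-\<^sup>1\<close> with zeros and applying \<open>P\<close>. So \<open>T\<close> and
  \<open>F\<close> have the same range, and \<open>T\<close> and \<open>G\<close> the same null space; in particular the outer inverses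
  prescribed by \<open>T\<close> alone and those prescribed by \<open>F\<close> and \<open>G\<close> are the same.

  Let \<open>L * F = 1\<close> and \<open>G * Y = 1\<close>, and let \<open>X\<close> be any outer inverse of \<open>S\<close> with the range and the
  null space of \<open>T\<close>. A left factor that fixes \<open>F\<close> fixes \<open>X\<close>, which has the same range; thus
  \<open>F * L * X = X\<close>. Two right factors that agree after \<open>X\<close> agree after \<open>G\<close>, which has the same
  null space, and conversely; thus \<open>X * S * X = X\<close> yields \<open>G * S * X = G\<close>, and \<open>G * Y * G = G\<close> yields
  \<open>X * Y * G = X\<close>. With \<open>N = L * X * Y\<close> one computes
  \<open>(G * S * F) * N = G * S * X * Y = G * Y = 1\<close> and \<open>F * N * G = X * Y * G = X\<close>. This gives
  the invertibility of \<open>G * S * F\<close>, the formula \<open>X = F * (G * S * F)\<^sup>-\<^sup>1 * G\<close>, and the uniqueness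
  of \<open>X\<close> all at once; \<open>N\<close> is a t-product of tensors, so it is a tensor and not only a
  matrix. The formula in terms of \<open>Qt\<^sup>* * T\<close> is the same one, because \<open>Qt\<^sup>* * T = G\<close>.

  The lemmas that carry this are \<open>tprod_tadjoint_of_unitary_dft_slices\<close> for \<open>P\<close>,
  \<open>tadjoint_tprod_tappend_cols_left\<close> and \<open>tappend_cols_tprod_tappend_rows_tzero\<close> for the blocks,
  and \<open>outer_inverse_full_rank_factorization\<close> for the second paragraph.
\<close>

section \<open>The t-product as an associative product with units\<close>

text \<open>
  This reduces an identity of tensors to one of block circulant matrices. Injectivity is read off
  from the uniqueness of a t-product with the identity tensor, whose block circulant matrix
  is \<open>bcirc A\<close> again.
\<close>

lemma bcirc_inject:
  assumes A: "A \<in> tensors a b n" and B: "B \<in> tensors a b n" and n: "0 < n"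
    and eq: "bcirc A = bcirc B"
  shows "A = B"
proof -
  have "bcirc C * bcirc (tid b n) = bcirc C" if "C \<in> tensors a b n" for C
    using bcirc_carrier[OF that n] by (simp add: tid[OF n])
  with tprod_ex1[OF A tid(1)[OF n] n] A B eq show ?thesis by metis
qed

lemma tprod_assoc:
  assumes A: "A \<in> tensors a b n" and B: "B \<in> tensors b c n" and C: "C \<in> tensors c d n"
    and n: "0 < n"
  shows "A *\<^sub>t B *\<^sub>t C = A *\<^sub>t (B *\<^sub>t C)"
proof (rule bcirc_inject[OF _ _ n])
  note AB = tprod[OF A B n] and BC = tprod[OF B C n]
  show "A *\<^sub>t B *\<^sub>t C \<in> tensors a d n" "A *\<^sub>t (B *\<^sub>t C) \<in> tensors a d n"
    using tprod(1)[OF AB(1) C n] tprod(1)[OF A BC(1) n] .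
  show "bcirc (A *\<^sub>t B *\<^sub>t C) = bcirc (A *\<^sub>t (B *\<^sub>t C))"
    using bcirc_carrier[OF A n] bcirc_carrier[OF B n] bcirc_carrier[OF C n]
    by (simp add: tprod(2)[OF AB(1) C n] tprod(2)[OF A BC(1) n] AB(2) BC(2))
qed

lemma tprod_tid_left:
  assumes A: "A \<in> tensors a b n" and n: "0 < n"
  shows "tid a n *\<^sub>t A = A"
  using tprod[OF tid(1)[OF n] A n] A bcirc_carrier[OF A n]
  by (intro bcirc_inject[OF _ _ n]) (auto simp: tid[OF n])

lemma tprod_tid_right:
  assumes A: "A \<in> tensors a b n" and n: "0 < n"
  shows "A *\<^sub>t tid b n = A"
  using tprod[OF A tid(1)[OF n] n] A bcirc_carrier[OF A n]
  by (intro bcirc_inject[OF _ _ n]) (auto simp: tid[OF n])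

lemma tprod_eq_tid_commute:
  assumes A: "A \<in> tensors m m n" and B: "B \<in> tensors m m n" and n: "0 < n"
    and AB: "A *\<^sub>t B = tid m n"
  shows "B *\<^sub>t A = tid m n"
proof (rule bcirc_inject[OF tprod(1)[OF B A n] tid(1)[OF n] n])
  have "bcirc A * bcirc B = 1\<^sub>m (m * n)"
    using tprod(2)[OF A B n] AB tid(2)[OF n] by simp
  then show "bcirc (B *\<^sub>t A) = bcirc (tid m n)"
    using mat_mult_left_right_inverse[OF bcirc_carrier[OF A n] bcirc_carrier[OF B n]]
    by (simp add: tprod(2)[OF B A n] tid(2)[OF n])
qed

lemma is_tinverse_of_right_inverse:
  assumes A: "A \<in> tensors m m n" and B: "B \<in> tensors m m n" and n: "0 < n"
    and AB: "A *\<^sub>t B = tid m n"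
  shows "is_tinverse A B"
  using assms tprod_eq_tid_commute[OF assms] tensors_dims[OF A n]
  by (simp add: is_tinverse_def)

lemma tinverse_eqI:
  assumes A: "A \<in> tensors m m n" and n: "0 < n" and inv: "is_tinverse A B"
  shows "tinverse A = B"
  unfolding tinverse_def
proof (rule the_equality[where P = "is_tinverse A", OF inv])
  fix C assume "is_tinverse A C"
  with inv have C: "C \<in> tensors m m n" "A *\<^sub>t C = tid m n"
    and B: "B \<in> tensors m m n" "B *\<^sub>t A = tid m n"
    using tensors_dims[OF A n] by (auto simp: is_tinverse_def)
  have "C = B *\<^sub>t A *\<^sub>t C" using tprod_tid_left[OF C(1) n] B(2) by simp
  also have "\<dots> = B" using tprod_assoc[OF B(1) A C(1) n] C(2) tprod_tid_right[OF B(1) n] by simp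
  finally show "C = B" .
qed

section \<open>Range and null space\<close>

lemma trange_eq:
  assumes A: "A \<in> tensors a b n" and n: "0 < n"
  shows "trange A = {bcirc A *\<^sub>v v | v. v \<in> carrier_vec (b * n)}"
  using vec_space.col_space_eq[OF bcirc_carrier[OF A n]] bcirc_carrier[OF A n]
  by (auto simp: trange_def)

lemma tnull_eq:
  assumes A: "A \<in> tensors a b n" and n: "0 < n"
  shows "tnull A = {v \<in> carrier_vec (b * n). bcirc A *\<^sub>v v = 0\<^sub>v (a * n)}"
  using mat_kernel[OF bcirc_carrier[OF A n]] by (simp add: tnull_def)

lemma trange_tprod_subset:
  assumes A: "A \<in> tensors a b n" and B: "B \<in> tensors b c n" and n: "0 < n"
  shows "trange (A *\<^sub>t B) \<subseteq> trange A"
proof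
  fix w assume "w \<in> trange (A *\<^sub>t B)"
  then obtain v where v: "v \<in> carrier_vec (c * n)" "w = bcirc A * bcirc B *\<^sub>v v"
    unfolding trange_eq[OF tprod(1)[OF A B n] n] tprod(2)[OF A B n] by blast
  have "w = bcirc A *\<^sub>v (bcirc B *\<^sub>v v)" and "bcirc B *\<^sub>v v \<in> carrier_vec (b * n)"
    using v bcirc_carrier[OF A n] bcirc_carrier[OF B n] by auto
  then show "w \<in> trange A" unfolding trange_eq[OF A n] by blast
qed

lemma tnull_tprod_superset:
  assumes A: "A \<in> tensors a b n" and B: "B \<in> tensors b c n" and n: "0 < n"
  shows "tnull B \<subseteq> tnull (A *\<^sub>t B)"
proof
  note cA = bcirc_carrier[OF A n] and cB = bcirc_carrier[OF B n]
  fix v assume "v \<in> tnull B"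
  then have v: "v \<in> carrier_vec (c * n)" "bcirc B *\<^sub>v v = 0\<^sub>v (b * n)"
    by (auto simp: tnull_eq[OF B n])
  have "bcirc A * bcirc B *\<^sub>v v = 0\<^sub>v (a * n)"
    using assoc_mult_mat_vec[OF cA cB v(1)] v(2) cA by (auto intro!: eq_vecI)
  with v(1) show "v \<in> tnull (A *\<^sub>t B)"
    unfolding tnull_eq[OF tprod(1)[OF A B n] n] tprod(2)[OF A B n] by blast
qed

lemma mult_mat_vec_unit_vec:
  fixes A :: "'a :: semiring_1 mat"
  assumes "A \<in> carrier_mat a b" and "j < b"
  shows "A *\<^sub>v unit_vec b j = col A j"
  using assms by (intro eq_vecI) auto

text \<open>
  Every column of \<open>bcirc X\<close> is a value of \<open>bcirc F\<close>, so a map that fixes all values of \<open>bcirc F\<close>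
  fixes it. This and the next lemma are the only ways in which the conditions on
  range and null space enter the main argument.
\<close>

lemma trange_subset_fixed:
  assumes X: "X \<in> tensors a b n" and F: "F \<in> tensors a c n" and C: "C \<in> tensors a a n"
    and n: "0 < n" and sub: "trange X \<subseteq> trange F" and fix_F: "C *\<^sub>t F = F"
  shows "C *\<^sub>t X = X"
proof (rule bcirc_inject[OF tprod(1)[OF C X n] X n])
  note cX = bcirc_carrier[OF X n] and cF = bcirc_carrier[OF F n] and cC = bcirc_carrier[OF C n]
  have CF: "bcirc C * bcirc F = bcirc F" using tprod(2)[OF C F n] fix_F by simp
  have col: "bcirc C *\<^sub>v col (bcirc X) j = col (bcirc X) j" if j: "j < b * n" for j
  proof -
    have "col (bcirc X) j \<in> trange X"
      unfolding trange_eq[OF X n]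
      using mult_mat_vec_unit_vec[OF cX j, symmetric] unit_vec_carrier[of "b * n" j] by blast
    then obtain v where v: "v \<in> carrier_vec (c * n)" "col (bcirc X) j = bcirc F *\<^sub>v v"
      using sub trange_eq[OF F n] by auto
    then have "bcirc C *\<^sub>v col (bcirc X) j = (bcirc C * bcirc F) *\<^sub>v v"
      using assoc_mult_mat_vec[OF cC cF v(1)] by simp
    then show ?thesis using CF v(2) by simp
  qed
  have "bcirc C * bcirc X = bcirc X"
  proof (rule mat_col_eqI)
    fix j assume "j < dim_col (bcirc X)"
    then have j: "j < b * n" using cX by simp
    show "col (bcirc C * bcirc X) j = col (bcirc X) j"
      using col[OF j] col_mult2[OF cC cX j] by simp
  qed (use cX cC in auto)
  then show "bcirc (C *\<^sub>t X) = bcirc X" by (simp add: tprod(2)[OF C X n])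
qed

text \<open>
  The columns of \<open>bcirc A - bcirc B\<close> lie in the null space of \<open>G\<close>, hence in that of \<open>X\<close>.
\<close>

lemma tnull_subset_cancel:
  assumes G: "G \<in> tensors a b n" and X: "X \<in> tensors d b n"
    and A: "A \<in> tensors b c n" and B: "B \<in> tensors b c n"
    and n: "0 < n" and sub: "tnull G \<subseteq> tnull X" and eq: "G *\<^sub>t A = G *\<^sub>t B"
  shows "X *\<^sub>t A = X *\<^sub>t B"
proof (rule bcirc_inject[OF tprod(1)[OF X A n] tprod(1)[OF X B n] n])
  note cG = bcirc_carrier[OF G n] and cX = bcirc_carrier[OF X n]
    and cA = bcirc_carrier[OF A n] and cB = bcirc_carrier[OF B n]
  have GAB: "bcirc G * bcirc A = bcirc G * bcirc B"
    using tprod(2)[OF G A n] tprod(2)[OF G B n] eq by simp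
  have col: "bcirc X *\<^sub>v col (bcirc A) j = bcirc X *\<^sub>v col (bcirc B) j" if j: "j < c * n" for j
  proof -
    have cols: "col (bcirc A) j \<in> carrier_vec (b * n)" "col (bcirc B) j \<in> carrier_vec (b * n)"
      using cA cB j by auto
    have "bcirc G *\<^sub>v (col (bcirc A) j - col (bcirc B) j) =
        col (bcirc G * bcirc A) j - col (bcirc G * bcirc B) j"
      using mult_minus_distrib_mat_vec[OF cG cols] col_mult2[OF cG cA j] col_mult2[OF cG cB j]
      by simp
    also have "\<dots> = 0\<^sub>v (a * n)" unfolding GAB using cG cB j by (intro eq_vecI) auto
    finally have "col (bcirc A) j - col (bcirc B) j \<in> tnull G"
      using cols by (auto simp: tnull_eq[OF G n])
    then have "bcirc X *\<^sub>v (col (bcirc A) j - col (bcirc B) j) = 0\<^sub>v (d * n)"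
      using sub by (auto simp: tnull_eq[OF X n])
    then have "bcirc X *\<^sub>v col (bcirc A) j - bcirc X *\<^sub>v col (bcirc B) j = 0\<^sub>v (d * n)"
      using mult_minus_distrib_mat_vec[OF cX cols] by simp
    moreover have "bcirc X *\<^sub>v col (bcirc A) j \<in> carrier_vec (d * n)"
      "bcirc X *\<^sub>v col (bcirc B) j \<in> carrier_vec (d * n)" using cX cols by auto
    ultimately show ?thesis
      by (intro eq_vecI) (auto simp: vec_eq_iff)
  qed
  have "bcirc X * bcirc A = bcirc X * bcirc B"
  proof (rule mat_col_eqI)
    fix j assume "j < dim_col (bcirc X * bcirc B)"
    then have j: "j < c * n" using cB by simp
    show "col (bcirc X * bcirc A) j = col (bcirc X * bcirc B) j"
      using col[OF j] col_mult2[OF cX cA j] col_mult2[OF cX cB j] by simp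
  qed (use cA cB in auto)
  then show "bcirc (X *\<^sub>t A) = bcirc (X *\<^sub>t B)"
    by (simp add: tprod(2)[OF X A n] tprod(2)[OF X B n])
qed

section \<open>Outer inverses from a full rank factorization\<close>

lemma trange_full_rank_factorization:
  assumes F: "F \<in> tensors q s n" and G: "G \<in> tensors s p n" and Y: "Y \<in> tensors p s n"
    and n: "0 < n" and GY: "G *\<^sub>t Y = tid s n"
  shows "trange (F *\<^sub>t G) = trange F"
proof
  have "F *\<^sub>t G *\<^sub>t Y = F"
    using tprod_assoc[OF F G Y n] GY tprod_tid_right[OF F n] by simp
  with trange_tprod_subset[OF tprod(1)[OF F G n] Y n] show "trange F \<subseteq> trange (F *\<^sub>t G)" by simp
qed (rule trange_tprod_subset[OF F G n])

lemma tnull_full_rank_factorization: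
  assumes F: "F \<in> tensors q s n" and G: "G \<in> tensors s p n" and L: "L \<in> tensors s q n"
    and n: "0 < n" and LF: "L *\<^sub>t F = tid s n"
  shows "tnull (F *\<^sub>t G) = tnull G"
proof
  have "L *\<^sub>t (F *\<^sub>t G) = G"
    using tprod_assoc[OF L F G n] LF tprod_tid_left[OF G n] by simp
  with tnull_tprod_superset[OF L tprod(1)[OF F G n] n] show "tnull (F *\<^sub>t G) \<subseteq> tnull G" by simp
qed (rule tnull_tprod_superset[OF F G n])

text \<open>
  The candidate inverse is forced: if \<open>X = F * N * G\<close>, then
  multiplying by the one-sided inverses of \<open>F\<close> and \<open>G\<close> gives \<open>N = L * X * Y\<close>.
\<close>

lemma outer_inverse_full_rank_factorization:
  assumes n: "0 < n" and S: "S \<in> tensors p q n"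
    and F: "F \<in> tensors q s n" and G: "G \<in> tensors s p n"
    and L: "L \<in> tensors s q n" and LF: "L *\<^sub>t F = tid s n"
    and Y: "Y \<in> tensors p s n" and GY: "G *\<^sub>t Y = tid s n"
    and X: "is_outer_inverse S F G X"
  shows "is_tinverse (G *\<^sub>t S *\<^sub>t F) (L *\<^sub>t X *\<^sub>t Y)"
    and "X = F *\<^sub>t tinverse (G *\<^sub>t S *\<^sub>t F) *\<^sub>t G"
proof -
  note tp = tprod(1)[OF _ _ n] and ti = tid(1)[OF n] and as = tprod_assoc[OF _ _ _ n]
  have tX: "X \<in> tensors q p n" and XSX: "X *\<^sub>t S *\<^sub>t X = X"
    and ran: "trange X = trange F" and nul: "tnull X = tnull G"
    using X tensors_dims[OF S n] by (auto simp: is_outer_inverse_def)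
  note SX = tp[OF S tX] and FL = tp[OF F L] and YG = tp[OF Y G] and LX = tp[OF L tX]
    and XY = tp[OF tX Y] and GS = tp[OF G S] and SF = tp[OF S F]
  note N = tp[OF LX Y] and GSF = tp[OF GS F]
  have FLX: "F *\<^sub>t L *\<^sub>t X = X"
  proof (rule trange_subset_fixed[OF tX F FL n])
    show "F *\<^sub>t L *\<^sub>t F = F" using as[OF F L F] LF tprod_tid_right[OF F n] by simp
  qed (simp add: ran)
  have "G *\<^sub>t (S *\<^sub>t X) = G *\<^sub>t tid p n"
  proof (rule tnull_subset_cancel[OF tX G SX ti n])
    show "X *\<^sub>t (S *\<^sub>t X) = X *\<^sub>t tid p n"
      using as[OF tX S tX] XSX tprod_tid_right[OF tX n] by simp
  qed (simp add: nul)
  then have GSX: "G *\<^sub>t (S *\<^sub>t X) = G" by (simp add: tprod_tid_right[OF G n])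
  have "X *\<^sub>t (Y *\<^sub>t G) = X *\<^sub>t tid p n"
  proof (rule tnull_subset_cancel[OF G tX YG ti n])
    show "G *\<^sub>t (Y *\<^sub>t G) = G *\<^sub>t tid p n"
      using as[OF G Y G] GY tprod_tid_left[OF G n] tprod_tid_right[OF G n] by simp
  qed (simp add: nul)
  then have XYG: "X *\<^sub>t (Y *\<^sub>t G) = X" by (simp add: tprod_tid_right[OF tX n])
  have FN: "F *\<^sub>t (L *\<^sub>t X *\<^sub>t Y) = X *\<^sub>t Y"
    using as[OF F LX Y] as[OF F L tX] FLX by simp
  have "G *\<^sub>t S *\<^sub>t F *\<^sub>t (L *\<^sub>t X *\<^sub>t Y) = G *\<^sub>t S *\<^sub>t (X *\<^sub>t Y)"
    using as[OF GS F N] FN by simp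
  also have "\<dots> = G *\<^sub>t (S *\<^sub>t X) *\<^sub>t Y"
    using as[OF GS tX Y] as[OF G S tX] by simp
  also have "\<dots> = tid s n" using GSX GY by simp
  finally show inv: "is_tinverse (G *\<^sub>t S *\<^sub>t F) (L *\<^sub>t X *\<^sub>t Y)"
    by (rule is_tinverse_of_right_inverse[OF GSF N n])
  have "F *\<^sub>t tinverse (G *\<^sub>t S *\<^sub>t F) *\<^sub>t G = X *\<^sub>t Y *\<^sub>t G"
    using tinverse_eqI[OF GSF n inv] FN by simp
  then show "X = F *\<^sub>t tinverse (G *\<^sub>t S *\<^sub>t F) *\<^sub>t G"
    using as[OF tX Y G] XYG by simp
qed

section \<open>Block partitions\<close>

lemma tensors_iff_nth:
  "A \<in> tensors a b n \<longleftrightarrow> length A = n \<and> (\<forall>k<n. A ! k \<in> carrier_mat a b)"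
  by (auto simp: tensors_def set_conv_nth)

lemma tappend_cols_carrier:
  assumes "A \<in> tensors a b n" and "B \<in> tensors a c n"
  shows "tappend_cols A B \<in> tensors a (b + c) n"
proof -
  have "four_block_mat (A ! k) (B ! k) (0\<^sub>m 0 (dim_col (A ! k))) (0\<^sub>m 0 (dim_col (B ! k)))
      \<in> carrier_mat (a + 0) (b + c)" if "k < n" for k
  proof (rule four_block_carrier_mat)
    have "A ! k \<in> carrier_mat a b" "B ! k \<in> carrier_mat a c"
      using assms that by (auto simp: tensors_iff_nth)
    then show "A ! k \<in> carrier_mat a b" "0\<^sub>m 0 (dim_col (B ! k)) \<in> carrier_mat 0 c" by auto
  qed
  with assms show ?thesis by (simp add: tensors_iff_nth tappend_cols_def)
qed

lemma tappend_rows_carrier: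
  assumes "A \<in> tensors a c n" and "B \<in> tensors b c n"
  shows "tappend_rows A B \<in> tensors (a + b) c n"
  using assms by (auto simp: tensors_iff_nth tappend_rows_def)

lemma tappend_cols_nth_index:
  assumes A: "A \<in> tensors a b n" and B: "B \<in> tensors a c n"
    and k: "k < n" and i: "i < a" and j: "j < b + c"
  shows "(tappend_cols A B ! k) $$ (i, j) =
    (if j < b then (A ! k) $$ (i, j) else (B ! k) $$ (i, j - b))"
proof -
  have "A ! k \<in> carrier_mat a b" "B ! k \<in> carrier_mat a c" "length A = n" "length B = n"
    using A B k by (auto simp: tensors_iff_nth)
  then show ?thesis using k i j by (auto simp: tappend_cols_def)
qed

lemma tappend_rows_nth_index:
  assumes A: "A \<in> tensors a c n" and B: "B \<in> tensors b c n"
    and k: "k < n" and i: "i < a + b" and j: "j < c"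
  shows "(tappend_rows A B ! k) $$ (i, j) =
    (if i < a then (A ! k) $$ (i, j) else (B ! k) $$ (i - a, j))"
proof -
  have "A ! k \<in> carrier_mat a c" "B ! k \<in> carrier_mat b c" "length A = n" "length B = n"
    using A B k by (auto simp: tensors_iff_nth)
  then show ?thesis using k i j by (auto simp: tappend_rows_def append_rows_def)
qed

lemma tfour_block_nth_index_upper:
  assumes A: "A \<in> tensors a b n" and B: "B \<in> tensors a c n"
    and C: "C \<in> tensors d b n" and D: "D \<in> tensors d c n"
    and k: "k < n" and i: "i < a" and j: "j < b + c"
  shows "(tfour_block A B C D ! k) $$ (i, j) =
    (if j < b then (A ! k) $$ (i, j) else (B ! k) $$ (i, j - b))"
proof -
  have "A ! k \<in> carrier_mat a b" "B ! k \<in> carrier_mat a c" "C ! k \<in> carrier_mat d b"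
    "D ! k \<in> carrier_mat d c" "length A = n"
    using A B C D k by (auto simp: tensors_iff_nth)
  then show ?thesis using k i j by (auto simp: tfour_block_def)
qed

lemma tzero_carrier: "tzero a b n \<in> tensors a b n"
  by (auto simp: tzero_def tensors_def)

lemma bcirc_tappend_cols_left:
  assumes A: "A \<in> tensors a b n" and B: "B \<in> tensors a c n" and n: "0 < n"
    and x: "x < a * n" and l: "l < n" and j: "j < b"
  shows "bcirc (tappend_cols A B) $$ (x, l * (b + c) + j) = bcirc A $$ (x, l * b + j)"
proof -
  let ?k = "nat ((int (x div a) - int l) mod int n)"
  have k: "?k < n" using n by (simp add: nat_less_iff)
  have a: "x mod a < a" using x by (metis mod_less_divisor mult_eq_0_iff not_gr_zero not_less0)
  have "(tappend_cols A B ! ?k) $$ (x mod a, j) = (A ! ?k) $$ (x mod a, j)"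
    using tappend_cols_nth_index[OF A B k a] j by simp
  then show ?thesis
    using block_index_less[OF l, of j "b + c"] block_index_less[OF l j] x j
    by (simp add: bcirc_index[OF tappend_cols_carrier[OF A B] n] bcirc_index[OF A n])
qed

lemma bcirc_tappend_rows_tzero:
  assumes C: "C \<in> tensors b d n" and n: "0 < n"
    and y: "y < d * n" and l: "l < n" and i: "i < b + c"
  shows "bcirc (tappend_rows C (tzero c d n)) $$ (l * (b + c) + i, y) =
    (if i < b then bcirc C $$ (l * b + i, y) else 0)"
proof -
  let ?k = "nat ((int l - int (y div d)) mod int n)"
  have k: "?k < n" using n by (simp add: nat_less_iff)
  have d: "y mod d < d" using y by (metis mod_less_divisor mult_eq_0_iff not_gr_zero not_less0)
  have "(tappend_rows C (tzero c d n) ! ?k) $$ (i, y mod d) =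
      (if i < b then (C ! ?k) $$ (i, y mod d) else 0)"
    using tappend_rows_nth_index[OF C tzero_carrier k i d] k i d by (simp add: tzero_def)
  then show ?thesis
    using block_index_less[OF l i] block_index_less[OF l, of i b] y i
    by (simp add: bcirc_index[OF tappend_rows_carrier[OF C tzero_carrier] n] bcirc_index[OF C n])
qed

text \<open>
  The zero rows of \<open>R\<close> remove \<open>Q2\<close> from \<open>Q * R\<close>, and padding the inverse of
  \<open>R11\<close> with zeros removes \<open>R22\<close> from \<open>[R11 R22]\<close> and so gives a right inverse.
\<close>

lemma tappend_cols_tprod_tappend_rows_tzero:
  assumes A: "A \<in> tensors a b n" and B: "B \<in> tensors a c n" and C: "C \<in> tensors b d n"
    and n: "0 < n"
  shows "tappend_cols A B *\<^sub>t tappend_rows C (tzero c d n) = A *\<^sub>t C"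
proof (rule bcirc_inject[OF _ tprod(1)[OF A C n] n])
  let ?U = "tappend_cols A B" and ?V = "tappend_rows C (tzero c d n)"
  note U = tappend_cols_carrier[OF A B] and V = tappend_rows_carrier[OF C tzero_carrier[of c d n]]
  note cU = bcirc_carrier[OF U n] and cV = bcirc_carrier[OF V n]
    and cA = bcirc_carrier[OF A n] and cC = bcirc_carrier[OF C n]
  show "?U *\<^sub>t ?V \<in> tensors a d n" using tprod(1)[OF U V n] .
  have "bcirc ?U * bcirc ?V = bcirc A * bcirc C"
  proof (rule eq_matI)
    fix x y assume "x < dim_row (bcirc A * bcirc C)" "y < dim_col (bcirc A * bcirc C)"
    then have xy: "x < a * n" "y < d * n" using cA cC by auto
    have "(bcirc ?U * bcirc ?V) $$ (x, y) =
        (\<Sum>z<(b + c) * n. bcirc ?U $$ (x, z) * bcirc ?V $$ (z, y))"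
      using cU cV xy by (auto simp: scalar_prod_def lessThan_atLeast0 intro!: sum.cong)
    also have "\<dots> = (\<Sum>l<n. \<Sum>i<b + c.
        bcirc ?U $$ (x, l * (b + c) + i) * bcirc ?V $$ (l * (b + c) + i, y))"
      by (rule sum_blocks)
    also have "\<dots> = (\<Sum>l<n. \<Sum>i<b. bcirc A $$ (x, l * b + i) * bcirc C $$ (l * b + i, y))"
      by (intro sum.cong[OF refl] sum.mono_neutral_cong_right)
        (auto simp: bcirc_tappend_cols_left[OF A B n xy(1)] bcirc_tappend_rows_tzero[OF C n xy(2)])
    also have "\<dots> = (\<Sum>z<b * n. bcirc A $$ (x, z) * bcirc C $$ (z, y))"
      by (rule sum_blocks[symmetric])
    also have "\<dots> = (bcirc A * bcirc C) $$ (x, y)"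
      using cA cC xy by (auto simp: scalar_prod_def lessThan_atLeast0 intro!: sum.cong)
    finally show "(bcirc ?U * bcirc ?V) $$ (x, y) = (bcirc A * bcirc C) $$ (x, y)" .
  qed (use cU cV cA cC in auto)
  then show "bcirc (?U *\<^sub>t ?V) = bcirc (A *\<^sub>t C)"
    by (simp add: tprod(2)[OF U V n] tprod(2)[OF A C n])
qed

lemma mat_adjoint_mult_index:
  assumes "M \<in> carrier_mat r c" and "i < c" and "j < c"
  shows "(mat_adjoint M * M) $$ (i, j) = (\<Sum>z<r. cnj (M $$ (z, i)) * M $$ (z, j))"
proof -
  have "mat_adjoint M \<in> carrier_mat c r" using assms unfolding carrier_mat_def
    by (simp add: mat_adjoint_def)
  then show ?thesis
    using assms by (auto simp: scalar_prod_def lessThan_atLeast0 mat_adjoint_index intro!: sum.cong)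
qed

text \<open>
  The Gram matrix of the columns belonging to \<open>A\<close> is a principal submatrix of the Gram
  matrix of all columns. In the block circulant matrix the columns of \<open>A\<close> are not contiguous:
  column \<open>y = l * b + j\<close> of \<open>bcirc A\<close> is column \<open>l * (b + c) + j\<close> of the larger matrix.
\<close>

lemma tadjoint_tprod_tappend_cols_left:
  assumes A: "A \<in> tensors a b n" and B: "B \<in> tensors a c n" and n: "0 < n"
    and unit: "tadjoint (tappend_cols A B) *\<^sub>t tappend_cols A B = tid (b + c) n"
  shows "tadjoint A *\<^sub>t A = tid b n"
proof (rule bcirc_inject[OF tprod(1)[OF tadjoint(1)[OF A n] A n] tid(1)[OF n] n])
  let ?U = "tappend_cols A B"
  define \<phi> where "\<phi> y = y div b * (b + c) + y mod b" for y
  note U = tappend_cols_carrier[OF A B]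
  note cU = bcirc_carrier[OF U n] and cA = bcirc_carrier[OF A n]
  have block: "y div b < n" "y mod b < b" if "y < b * n" for y
    using that by (cases b; simp add: less_mult_imp_div_less mult.commute)+
  have \<phi>_less: "\<phi> y < (b + c) * n" if "y < b * n" for y
    unfolding \<phi>_def using block_index_less[OF block(1)[OF that], of "y mod b" "b + c"] block(2)[OF that]
    by simp
  have \<phi>_inj: "\<phi> x = \<phi> y \<longleftrightarrow> x = y" if "x < b * n" "y < b * n" for x y
  proof
    assume eq: "\<phi> x = \<phi> y"
    have "\<phi> z div (b + c) = z div b \<and> \<phi> z mod (b + c) = z mod b" if "z < b * n" for z
      using block(2)[OF that] by (simp add: \<phi>_def)
    with that eq show "x = y" by (metis div_mult_mod_eq)
  qed simp
  have entry: "bcirc A $$ (z, y) = bcirc ?U $$ (z, \<phi> y)" if "z < a * n" "y < b * n" for z y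
    unfolding \<phi>_def bcirc_tappend_cols_left[OF A B n that(1) block[OF that(2)]] by simp
  have gram: "mat_adjoint (bcirc ?U) * bcirc ?U = 1\<^sub>m ((b + c) * n)"
    using tprod(2)[OF tadjoint(1)[OF U n] U n] tadjoint(2)[OF U n] unit tid(2)[OF n] by simp
  have "mat_adjoint (bcirc A) * bcirc A = 1\<^sub>m (b * n)"
  proof (rule eq_matI)
    fix x y assume "x < dim_row (1\<^sub>m (b * n) :: complex mat)" "y < dim_col (1\<^sub>m (b * n) :: complex mat)"
    then have xy: "x < b * n" "y < b * n" by auto
    have "(mat_adjoint (bcirc A) * bcirc A) $$ (x, y) =
        (mat_adjoint (bcirc ?U) * bcirc ?U) $$ (\<phi> x, \<phi> y)"
      using xy by (simp add: mat_adjoint_mult_index[OF cA] mat_adjoint_mult_index[OF cU] \<phi>_less entry)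
    also have "\<dots> = 1\<^sub>m (b * n) $$ (x, y)"
      unfolding gram using xy by (simp add: \<phi>_less \<phi>_inj)
    finally show "(mat_adjoint (bcirc A) * bcirc A) $$ (x, y) = 1\<^sub>m (b * n) $$ (x, y)" .
  qed (use cA in \<open>auto simp: mat_adjoint_def\<close>)
  then show "bcirc (tadjoint A *\<^sub>t A) = bcirc (tid b n)"
    by (simp add: tprod(2)[OF tadjoint(1)[OF A n] A n] tadjoint(2)[OF A n] tid(2)[OF n])
qed

text \<open>
  This identifies the upper block row of \<open>R\<close> as \<open>[R11 R22]\<close>, so that a right inverse of it can be
  made from the inverse of \<open>R11\<close>.
\<close>

lemma tappend_rows_eq_tfour_block_upper:
  assumes A: "A \<in> tensors a b n" and B: "B \<in> tensors a c n" and C: "C \<in> tensors d b n"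
    and D: "D \<in> tensors d c n" and E: "E \<in> tensors a (b + c) n" and Z: "Z \<in> tensors d (b + c) n"
    and eq: "tfour_block A B C D = tappend_rows E Z"
  shows "E = tappend_cols A B"
proof (rule nth_equalityI)
  note U = tappend_cols_carrier[OF A B]
  show "length E = length (tappend_cols A B)" using E U by (simp add: tensors_iff_nth)
  fix k assume "k < length E"
  then have k: "k < n" using E by (simp add: tensors_iff_nth)
  have c: "E ! k \<in> carrier_mat a (b + c)" "tappend_cols A B ! k \<in> carrier_mat a (b + c)"
    using E U k by (auto simp: tensors_iff_nth)
  show "E ! k = tappend_cols A B ! k"
  proof (rule eq_matI)
    fix i j assume "i < dim_row (tappend_cols A B ! k)" "j < dim_col (tappend_cols A B ! k)"
    then have ij: "i < a" "j < b + c" using c by auto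
    then show "(E ! k) $$ (i, j) = (tappend_cols A B ! k) $$ (i, j)"
      using tappend_rows_nth_index[OF E Z k _ ij(2)] tfour_block_nth_index_upper[OF A B C D k ij]
        tappend_cols_nth_index[OF A B k ij] eq by simp
  qed (use c in auto)
qed

section \<open>Permutation tensors are unitary\<close>

lemma fourier_root_power:
  "exp (- 2 * of_real pi * \<i> / of_nat n) ^ i = cnj (cis (2 * pi * real i / real n))"
proof -
  have "exp (- 2 * of_real pi * \<i> / of_nat n) = cis (- (2 * pi / real n))"
    by (simp add: cis_conv_exp mult_ac)
  then show ?thesis by (simp add: DeMoivre cis_cnj mult_ac)
qed

lemma fourier_root_power_mult_cnj:
  "exp (- 2 * of_real pi * \<i> / of_nat n) ^ i * cnj (exp (- 2 * of_real pi * \<i> / of_nat n) ^ i) = 1"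
  unfolding fourier_root_power by (simp add: cis_cnj cis_mult)

lemma roots_of_unity_orthogonal:
  fixes k m n :: nat
  assumes n: "0 < n" and k: "k < n" and m: "m < n"
  defines "\<omega> \<equiv> exp (- 2 * of_real pi * \<i> / of_nat n)"
  shows "(\<Sum>j<n. \<omega> ^ (j * k) * cnj (\<omega> ^ (j * m))) = (if k = m then of_nat n else 0)"
proof -
  note \<omega> = fourier_root_power[of n, folded \<omega>_def]
    and norm = fourier_root_power_mult_cnj[of n, folded \<omega>_def]
  have \<omega>n: "\<omega> ^ n = 1" unfolding \<omega> using n by simp
  define z where "z = \<omega> ^ k * cnj (\<omega> ^ m)"
  have "z ^ n = (\<omega> ^ n) ^ k * cnj ((\<omega> ^ n) ^ m)"
    by (simp add: z_def power_mult_distrib power_mult[symmetric] mult.commute)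
  then have zn: "z ^ n = 1" by (simp add: \<omega>n)
  have sum: "(\<Sum>j<n. \<omega> ^ (j * k) * cnj (\<omega> ^ (j * m))) = (\<Sum>j<n. z ^ j)"
    by (simp add: z_def power_mult_distrib power_mult[symmetric] mult.commute)
  show ?thesis
  proof (cases "k = m")
    case True
    then show ?thesis unfolding sum by (simp add: z_def norm del: complex_cnj_power)
  next
    case False
    have "z \<noteq> 1"
    proof
      assume "z = 1"
      then have "\<omega> ^ k = \<omega> ^ m"
        using norm[of m] by (metis z_def mult.assoc mult.commute mult_1)
      then have "cis (2 * pi * real k / real n) = cis (2 * pi * real m / real n)"
        unfolding \<omega> by (simp only: complex_cnj_cancel_iff)
      then show False
        using bij_betw_imp_inj_on[OF bij_betw_roots_unity[OF n]] k m False
        by (auto dest: inj_onD)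
    qed
    then show ?thesis unfolding sum using False zn by (simp add: geometric_sum)
  qed
qed

text \<open>
  By Fourier inversion the block of \<open>bcirc A\<close> in position \<open>(k, l)\<close> is the average over \<open>j\<close> of the slices
  \<open>dft_slice A j\<close>, weighted by a character of \<open>k - l\<close>, which splits into a factor
  for \<open>k\<close> and a factor for \<open>l\<close>. This is the block diagonalization of \<open>bcirc A\<close> by the Fourier matrix.
\<close>

lemma bcirc_dft:
  assumes A: "A \<in> tensors a b n" and n: "0 < n"
    and k: "k < n" and l: "l < n" and i: "i < a" and i': "i' < b"
  defines "\<omega> \<equiv> exp (- 2 * of_real pi * \<i> / of_nat n)"
  shows "of_nat n * bcirc A $$ (k * a + i, l * b + i') =
    (\<Sum>j<n. cnj (\<omega> ^ (j * k)) * \<omega> ^ (j * l) * dft_slice A j $$ (i, i'))"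
proof -
  define m where "m = nat ((int k - int l) mod int n)"
  have m: "m < n" using n by (simp add: m_def nat_less_iff)
  note \<omega> = fourier_root_power[of n, folded \<omega>_def]
    and norm = fourier_root_power_mult_cnj[of n, folded \<omega>_def]
  have \<omega>n: "\<omega> ^ n = 1" unfolding \<omega> using n by simp
  have \<omega>mod: "\<omega> ^ (x mod n) = \<omega> ^ x" for x
    by (metis \<omega>n div_mult_mod_eq mult_1 power_add power_mult power_one mult.commute)
  have "(m + l) mod n = k"
  proof -
    have "int ((m + l) mod n) = int k"
      using n k by (simp add: m_def zmod_int mod_add_left_eq)
    then show ?thesis by simp
  qed
  then have ml: "\<omega> ^ m * \<omega> ^ l = \<omega> ^ k" using \<omega>mod[of "m + l"] by (simp add: power_add)
  then have "cnj (\<omega> ^ k) * \<omega> ^ l = cnj (\<omega> ^ m) * (\<omega> ^ l * cnj (\<omega> ^ l))"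
    by (metis complex_cnj_mult mult.assoc mult.commute)
  then have "cnj (\<omega> ^ k) * \<omega> ^ l = cnj (\<omega> ^ m)" by (simp only: norm mult_1_right)
  then have char: "cnj (\<omega> ^ (j * k)) * \<omega> ^ (j * l) = cnj (\<omega> ^ (j * m))" for j
    by (metis (no_types) complex_cnj_power mult.commute power_mult power_mult_distrib)
  have dft: "dft_slice A j $$ (i, i') = (\<Sum>t<n. \<omega> ^ (j * t) * (A ! t) $$ (i, i'))" for j
    using tensors_dims[OF A n] i i' by (simp add: dft_slice_def Let_def \<omega>_def)
  have "(\<Sum>j<n. cnj (\<omega> ^ (j * k)) * \<omega> ^ (j * l) * dft_slice A j $$ (i, i')) =
      (\<Sum>j<n. \<Sum>t<n. (\<omega> ^ (j * t) * cnj (\<omega> ^ (j * m))) * (A ! t) $$ (i, i'))"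
    unfolding char dft by (simp add: sum_distrib_left mult_ac)
  also have "\<dots> = (\<Sum>t<n. \<Sum>j<n. (\<omega> ^ (j * t) * cnj (\<omega> ^ (j * m))) * (A ! t) $$ (i, i'))"
    by (rule sum.swap)
  also have "\<dots> = (\<Sum>t<n. (\<Sum>j<n. \<omega> ^ (j * t) * cnj (\<omega> ^ (j * m))) * (A ! t) $$ (i, i'))"
    by (simp only: sum_distrib_right)
  also have "\<dots> = (\<Sum>t<n. (if t = m then of_nat n else 0) * (A ! t) $$ (i, i'))"
    unfolding \<omega>_def by (intro sum.cong refl) (simp only: roots_of_unity_orthogonal[OF n _ m] lessThan_iff)
  also have "\<dots> = of_nat n * (A ! m) $$ (i, i')"
    using m by (simp add: if_distrib[of "\<lambda>c. c * _"] sum.delta cong: if_cong)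
  also have "(A ! m) $$ (i, i') = bcirc A $$ (k * a + i, l * b + i')"
    using block_index_less[OF k i] block_index_less[OF l i'] i i'
    by (simp add: bcirc_index[OF A n] m_def)
  finally show ?thesis by simp
qed

lemma mat_mult_adjoint_index:
  assumes "M \<in> carrier_mat r c" and "i < r" and "j < r"
  shows "(M * mat_adjoint M) $$ (i, j) = (\<Sum>z<c. M $$ (i, z) * cnj (M $$ (j, z)))"
proof -
  have "mat_adjoint M \<in> carrier_mat c r" using assms unfolding carrier_mat_def
    by (simp add: mat_adjoint_def)
  then show ?thesis
    using assms by (auto simp: scalar_prod_def lessThan_atLeast0 mat_adjoint_index intro!: sum.cong)
qed

lemma sum_rotate:
  fixes h :: "'i \<Rightarrow> 'j \<Rightarrow> 'k \<Rightarrow> 'a :: comm_monoid_add"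
  shows "(\<Sum>l\<in>A. \<Sum>i\<in>B. \<Sum>j\<in>C. h l i j) = (\<Sum>j\<in>C. \<Sum>l\<in>A. \<Sum>i\<in>B. h l i j)"
proof -
  have "(\<Sum>l\<in>A. \<Sum>i\<in>B. \<Sum>j\<in>C. h l i j) = (\<Sum>l\<in>A. \<Sum>j\<in>C. \<Sum>i\<in>B. h l i j)"
    by (intro sum.cong refl sum.swap)
  also have "\<dots> = (\<Sum>j\<in>C. \<Sum>l\<in>A. \<Sum>i\<in>B. h l i j)" by (rule sum.swap)
  finally show ?thesis .
qed

text \<open>
  In the Fourier basis \<open>bcirc A\<close> is block diagonal with the Fourier slices as blocks, and the
  Fourier matrix is unitary up to the factor \<open>n\<close>. Entrywise: expand both factors by
  Fourier inversion; summing over the inner block index \<open>l\<close> kills all mixed terms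
  \<open>j \<noteq> j'\<close>, the slices contribute the Kronecker delta inside a block, and the remaining
  sum over \<open>j\<close> is the Kronecker delta of the block positions.
\<close>

lemma tprod_tadjoint_of_unitary_dft_slices:
  assumes A: "A \<in> tensors a b n" and n: "0 < n"
    and unit: "\<And>j. j < n \<Longrightarrow> dft_slice A j * mat_adjoint (dft_slice A j) = 1\<^sub>m a"
  shows "A *\<^sub>t tadjoint A = tid a n"
proof (rule bcirc_inject[OF tprod(1)[OF A tadjoint(1)[OF A n] n] tid(1)[OF n] n])
  note cA = bcirc_carrier[OF A n]
  define \<omega> where "\<omega> = exp (- 2 * of_real pi * \<i> / of_nat n)"
  note dft = bcirc_dft[OF A n, folded \<omega>_def]
    and orth = roots_of_unity_orthogonal[OF n, folded \<omega>_def]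
  define D where "D j i i' = dft_slice A j $$ (i, i')" for j i i'
  have slice: "(\<Sum>z<b. D j i z * cnj (D j i' z)) = (if i = i' then 1 else 0)"
    if "j < n" "i < a" "i' < a" for j i i'
  proof -
    have "dft_slice A j \<in> carrier_mat a b"
      using tensors_dims[OF A n] by (simp add: dft_slice_def Let_def)
    from mat_mult_adjoint_index[OF this that(2,3)] unit[OF that(1)] that(2,3)
    show ?thesis by (simp add: D_def)
  qed
  have entry: "of_nat n * of_nat n * (bcirc A * mat_adjoint (bcirc A)) $$ (k * a + i, m * a + i') =
      of_nat n * of_nat n * (if k = m \<and> i = i' then 1 else 0)"
    if k: "k < n" and m: "m < n" and i: "i < a" and i': "i' < a" for k m i i'
  proof -
    let ?M = "\<lambda>x l z. bcirc A $$ (x, l * b + z)"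
    let ?c = "\<lambda>j j'. cnj (\<omega> ^ (j * k)) * \<omega> ^ (j' * m)"
    let ?u = "\<lambda>j j' l. \<omega> ^ (l * j) * cnj (\<omega> ^ (l * j'))"
    let ?v = "\<lambda>j j' z. D j i z * cnj (D j' i' z)"
    have "of_nat n * of_nat n * (bcirc A * mat_adjoint (bcirc A)) $$ (k * a + i, m * a + i') =
        of_nat n * of_nat n * (\<Sum>l<n. \<Sum>z<b. ?M (k * a + i) l z * cnj (?M (m * a + i') l z))"
      using mat_mult_adjoint_index[OF cA block_index_less[OF k i] block_index_less[OF m i']]
      by (simp add: sum_blocks)
    also have "\<dots> = (\<Sum>l<n. \<Sum>z<b.
        (of_nat n * ?M (k * a + i) l z) * cnj (of_nat n * ?M (m * a + i') l z))"
      by (simp add: sum_distrib_left mult_ac)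
    also have "\<dots> = (\<Sum>l<n. \<Sum>z<b.
        (\<Sum>j<n. cnj (\<omega> ^ (j * k)) * \<omega> ^ (j * l) * D j i z) *
        cnj (\<Sum>j<n. cnj (\<omega> ^ (j * m)) * \<omega> ^ (j * l) * D j i' z))"
      by (intro sum.cong refl) (simp add: dft[OF k _ i] dft[OF m _ i'] D_def
          del: complex_cnj_mult complex_cnj_power cnj_sum)
    also have "\<dots> = (\<Sum>l<n. \<Sum>z<b. \<Sum>j<n. \<Sum>j'<n. ?c j j' * (?u j j' l * ?v j j' z))"
      by (simp add: sum_product mult_ac)
    also have "\<dots> = (\<Sum>j<n. \<Sum>l<n. \<Sum>z<b. \<Sum>j'<n. ?c j j' * (?u j j' l * ?v j j' z))"
      by (rule sum_rotate)
    also have "\<dots> = (\<Sum>j<n. \<Sum>j'<n. \<Sum>l<n. \<Sum>z<b. ?c j j' * (?u j j' l * ?v j j' z))"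
      by (intro sum.cong refl sum_rotate)
    also have "\<dots> = (\<Sum>j<n. \<Sum>j'<n. ?c j j' * ((\<Sum>l<n. ?u j j' l) * (\<Sum>z<b. ?v j j' z)))"
      by (intro sum.cong refl, unfold sum_product, simp only: sum_distrib_left)
    also have "\<dots> = (\<Sum>j<n. \<Sum>j'<n. if j = j' then ?c j j' * (of_nat n * (\<Sum>z<b. ?v j j' z)) else 0)"
      by (intro sum.cong refl) (simp add: orth del: complex_cnj_power)
    also have "\<dots> = (\<Sum>j<n. ?c j j * (of_nat n * (\<Sum>z<b. ?v j j z)))"
      by (simp add: sum.delta')
    also have "\<dots> = (\<Sum>j<n. ?c j j * (of_nat n * (if i = i' then 1 else 0)))"
      by (intro sum.cong refl) (simp add: slice i i')
    also have "\<dots> = (\<Sum>j<n. \<omega> ^ (j * m) * cnj (\<omega> ^ (j * k))) * (of_nat n * (if i = i' then 1 else 0))"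
      unfolding sum_distrib_right by (intro sum.cong refl) (simp only: mult_ac)
    also have "\<dots> = of_nat n * of_nat n * (if k = m \<and> i = i' then 1 else 0)"
      unfolding orth[OF m k] by simp
    finally show ?thesis .
  qed
  have "bcirc A * mat_adjoint (bcirc A) = 1\<^sub>m (a * n)"
  proof (rule eq_matI)
    fix x y assume "x < dim_row (1\<^sub>m (a * n) :: complex mat)" "y < dim_col (1\<^sub>m (a * n) :: complex mat)"
    then have xy: "x < a * n" "y < a * n" by auto
    have block: "z div a < n" "z mod a < a" if "z < a * n" for z
      using that by (cases a; simp add: less_mult_imp_div_less mult.commute)+
    have "x = y \<longleftrightarrow> x div a = y div a \<and> x mod a = y mod a" by (metis div_mult_mod_eq)
    then show "(bcirc A * mat_adjoint (bcirc A)) $$ (x, y) = 1\<^sub>m (a * n) $$ (x, y)"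
      using entry[OF block(1)[OF xy(1)] block(1)[OF xy(2)] block(2)[OF xy(1)] block(2)[OF xy(2)]] n xy
      by simp
  qed (use cA in \<open>auto simp: mat_adjoint_def\<close>)
  then show "bcirc (A *\<^sub>t tadjoint A) = bcirc (tid a n)"
    by (simp add: tprod(2)[OF A tadjoint(1)[OF A n] n] tadjoint(2)[OF A n] tid(2)[OF n])
qed

lemma permutation_matrix_unitary:
  assumes "permutation_matrix p M"
  shows "M * mat_adjoint M = 1\<^sub>m p"
proof -
  obtain \<pi> where \<pi>: "\<pi> permutes {..<p}" and M: "M = mat p p (\<lambda>(i, j). if i = \<pi> j then 1 else 0)"
    using assms by (auto simp: permutation_matrix_def)
  have cM: "M \<in> carrier_mat p p" by (simp add: M)
  show ?thesis
  proof (rule eq_matI)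
    fix i j assume "i < dim_row (1\<^sub>m p :: complex mat)" "j < dim_col (1\<^sub>m p :: complex mat)"
    then have ij: "i < p" "j < p" by auto
    have i: "inv_into UNIV \<pi> i < p" using permutes_in_image[OF permutes_inv[OF \<pi>]] ij(1) by auto
    have eq: "i = \<pi> z \<longleftrightarrow> z = inv_into UNIV \<pi> i" for z
      using permutes_inverses[OF \<pi>] by metis
    have "(M * mat_adjoint M) $$ (i, j) = (\<Sum>z<p. M $$ (i, z) * cnj (M $$ (j, z)))"
      by (rule mat_mult_adjoint_index[OF cM ij])
    also have "\<dots> = (\<Sum>z<p. if z = inv_into UNIV \<pi> i then cnj (M $$ (j, z)) else 0)"
      using ij by (intro sum.cong refl) (simp add: M eq)
    also have "\<dots> = cnj (M $$ (j, inv_into UNIV \<pi> i))" using i by simp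
    also have "\<dots> = 1\<^sub>m p $$ (i, j)"
      using i ij permutes_inverses[OF \<pi>] by (auto simp: M)
    finally show "(M * mat_adjoint M) $$ (i, j) = 1\<^sub>m p $$ (i, j)" .
  qed (use cM in \<open>auto simp: mat_adjoint_def\<close>)
qed

lemma permutation_tensor_unitary:
  assumes "permutation_tensor p n P" and "0 < n"
  shows "P *\<^sub>t tadjoint P = tid p n"
  using assms by (intro tprod_tadjoint_of_unitary_dft_slices permutation_matrix_unitary)
    (auto simp: permutation_tensor_def)

section \<open>The outer inverse with the range and null space of \<open>T\<close>\<close>

theorem theorem3p15:
  fixes p q n r s :: nat
    and S T P Q R Qt Q2 R11 R22 Rt :: tensor
  assumes "0 < n"
    and "S \<in> tensors p q n" and "T \<in> tensors q p n"
    and "trank T = s * n" and "trank S = r * n" and "s * n \<le> r * n"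
    and "permutation_tensor p n P"
    and "Q \<in> tensors q q n" and "tadjoint Q *\<^sub>t Q = tid q n"
    and "R \<in> tensors q p n" and "trank R = s * n"
    and "T *\<^sub>t P = Q *\<^sub>t R"
    and "s \<le> p" and "s \<le> q"
    and "Qt \<in> tensors q s n" and "Q2 \<in> tensors q (q - s) n"
    and "Q = tappend_cols Qt Q2"
    and "R11 \<in> tensors s s n" and "tinvertible R11" and "R22 \<in> tensors s (p - s) n"
    and "R = tfour_block R11 R22 (tzero (q - s) s n) (tzero (q - s) (p - s) n)"
    and "Rt \<in> tensors s p n"
    and "R = tappend_rows Rt (tzero (q - s) p n)"
    and "\<exists>X. is_outer_inverse S T T X"
  shows "tinvertible (Rt *\<^sub>t tadjoint P *\<^sub>t S *\<^sub>t Qt)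
    \<and> outer_inverse S T T =
        Qt *\<^sub>t tinverse (Rt *\<^sub>t tadjoint P *\<^sub>t S *\<^sub>t Qt) *\<^sub>t Rt *\<^sub>t tadjoint P
    \<and> (\<exists>X. is_outer_inverse S Qt (Rt *\<^sub>t tadjoint P) X)
    \<and> outer_inverse S T T = outer_inverse S Qt (Rt *\<^sub>t tadjoint P)
    \<and> tinvertible (tadjoint Qt *\<^sub>t T *\<^sub>t S *\<^sub>t Qt)
    \<and> outer_inverse S T T =
        Qt *\<^sub>t tinverse (tadjoint Qt *\<^sub>t T *\<^sub>t S *\<^sub>t Qt) *\<^sub>t tadjoint Qt *\<^sub>t T"
proof -
  note n = assms(1) and S = assms(2) and T = assms(3) and Q = assms(8) and R = assms(10)
    and Qt = assms(15) and Q2 = assms(16) and R11 = assms(18) and R22 = assms(20) and Rt = assms(22)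
  note tp = tprod(1)[OF _ _ n] and as = tprod_assoc[OF _ _ _ n]
  have P: "P \<in> tensors p p n" using assms(7) by (simp add: permutation_tensor_def)
  note Pa = tadjoint(1)[OF P n] and L = tadjoint(1)[OF Qt n]
  have PPa: "P *\<^sub>t tadjoint P = tid p n" by (rule permutation_tensor_unitary[OF assms(7) n])
  have PaP: "tadjoint P *\<^sub>t P = tid p n" by (rule tprod_eq_tid_commute[OF P Pa n PPa])
  define G where "G = Rt *\<^sub>t tadjoint P"
  have G: "G \<in> tensors s p n" unfolding G_def by (rule tp[OF Rt Pa])
  have QR: "Q *\<^sub>t R = Qt *\<^sub>t Rt"
    unfolding assms(17,23) by (rule tappend_cols_tprod_tappend_rows_tzero[OF Qt Q2 Rt n])
  have "T = T *\<^sub>t P *\<^sub>t tadjoint P" using as[OF T P Pa] PPa tprod_tid_right[OF T n] by simp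
  also have "\<dots> = Qt *\<^sub>t G" unfolding assms(12) QR G_def by (rule as[OF Qt Rt Pa])
  finally have TG: "T = Qt *\<^sub>t G" .
  have LQt: "tadjoint Qt *\<^sub>t Qt = tid s n"
    using tadjoint_tprod_tappend_cols_left[OF Qt Q2 n] assms(9,14,17) by simp
  obtain B where B: "B \<in> tensors s s n" and R11B: "R11 *\<^sub>t B = tid s n"
    using assms(19) tensors_dims[OF R11 n] by (auto simp: tinvertible_def is_tinverse_def)
  define Y where "Y = tappend_rows B (tzero (p - s) s n)"
  have Y: "Y \<in> tensors p s n"
    using tappend_rows_carrier[OF B tzero_carrier[of "p - s" s n]] assms(13) by (simp add: Y_def)
  have "Rt = tappend_cols R11 R22"
    by (rule tappend_rows_eq_tfour_block_upper[OF R11 R22, where d = "q - s"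
          and C = "tzero (q - s) s n" and D = "tzero (q - s) (p - s) n" and Z = "tzero (q - s) p n"])
      (use assms(13,21,22,23) tzero_carrier in auto)
  then have RtY: "Rt *\<^sub>t Y = tid s n"
    using tappend_cols_tprod_tappend_rows_tzero[OF R11 R22 B n] R11B by (simp add: Y_def)
  note PY = tp[OF P Y]
  have "tadjoint P *\<^sub>t (P *\<^sub>t Y) = Y"
    using as[OF Pa P Y] PaP tprod_tid_left[OF Y n] by simp
  then have GPY: "G *\<^sub>t (P *\<^sub>t Y) = tid s n"
    using as[OF Rt Pa PY] RtY by (simp add: G_def)
  have "trange T = trange Qt" and "tnull T = tnull G"
    unfolding TG by (rule trange_full_rank_factorization[OF Qt G PY n GPY],
        rule tnull_full_rank_factorization[OF Qt G L n LQt])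
  then have outer_iff: "is_outer_inverse S T T = is_outer_inverse S Qt G"
    by (simp add: is_outer_inverse_def fun_eq_iff)
  note formula = outer_inverse_full_rank_factorization[OF n S Qt G L LQt PY GPY]
  let ?N = "tinverse (G *\<^sub>t S *\<^sub>t Qt)"
  obtain X where X: "is_outer_inverse S Qt G X" using assms(24) outer_iff by auto
  have GSQt: "G *\<^sub>t S *\<^sub>t Qt \<in> tensors s s n" by (rule tp[OF tp[OF G S] Qt])
  have inv: "is_tinverse (G *\<^sub>t S *\<^sub>t Qt) ?N"
    using formula(1)[OF X] tinverse_eqI[OF GSQt n formula(1)[OF X]] by simp
  then have N: "?N \<in> tensors s s n"
    using tensors_dims[OF GSQt n] by (simp add: is_tinverse_def)
  have outer: "outer_inverse S T T = Qt *\<^sub>t ?N *\<^sub>t G"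
    unfolding outer_inverse_def outer_iff
    by (rule the_equality) (use X formula(2) in auto)
  have LT: "tadjoint Qt *\<^sub>t T = G"
    unfolding TG using as[OF L Qt G] LQt tprod_tid_left[OF G n] by simp
  note QtN = tp[OF Qt N]
  show ?thesis
  proof (intro conjI)
    show "tinvertible (Rt *\<^sub>t tadjoint P *\<^sub>t S *\<^sub>t Qt)"
      using inv by (auto simp: tinvertible_def G_def)
    show "outer_inverse S T T =
        Qt *\<^sub>t tinverse (Rt *\<^sub>t tadjoint P *\<^sub>t S *\<^sub>t Qt) *\<^sub>t Rt *\<^sub>t tadjoint P"
      using outer as[OF QtN Rt Pa] by (simp add: G_def)
    show "\<exists>X. is_outer_inverse S Qt (Rt *\<^sub>t tadjoint P) X"
      using X by (auto simp: G_def)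
    show "outer_inverse S T T = outer_inverse S Qt (Rt *\<^sub>t tadjoint P)"
      by (simp add: outer_inverse_def outer_iff G_def)
    show "tinvertible (tadjoint Qt *\<^sub>t T *\<^sub>t S *\<^sub>t Qt)"
      using inv by (auto simp: tinvertible_def LT)
    show "outer_inverse S T T =
        Qt *\<^sub>t tinverse (tadjoint Qt *\<^sub>t T *\<^sub>t S *\<^sub>t Qt) *\<^sub>t tadjoint Qt *\<^sub>t T"
      using outer as[OF QtN L T] by (simp add: LT)
  qed
qed

end
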